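(* Let $d\ge1$, $\sigma\in(0,1)$, $\mu_1,\mu_2\in\mathbb R^d$ with $\|\mu_1\|=\|\mu_2\|$, and $\pi_1,\pi_2>0$ with $\pi_1+\pi_2=1$ and $\pi_1<\pi_2$. Consider the conditional data law $p_0(x\mid y)=\pi_1\mathcal N(x;\mu_1,\sigma^2I_d)+\pi_2\mathcal N(x;\mu_2,\sigma^2I_d)$ and put $\bar\mu=\pi_1\mu_1+\pi_2\mu_2$. Let $\omega\ge1$ and let $x_t$ evolve under the CFG probability flow ODE with weight $\omega$. Then there exists $t_{s_1}$ with $0<t_{s_1}<1$ such that for every $k>1$ one can find a radius $r(k)>0$ with the following property: if $$\|x_{t_{s_1}}-k\bar\mu\|<r(k),$$ then for all $t\in[0,t_{s_1}]$, $$\pi_1\,\mathcal N\big(x_t;(1-t)\mu_1,(t^2+(1-t)^2\sigma^2)I_d\big)<\pi_2\,\mathcal N\big(x_t;(1-t)\mu_2,(t^2+(1-t)^2\sigma^2)I_d\big).$$ Moreover, $r(k)$ grows monotonically with $k$ (i.e. the radii can be chosen so that $k\mapsto r(k)$ is increasing).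
   Context: Here $\mathcal N(x;m,C)$ denotes the Gaussian density with mean $m$ and covariance $C$ evaluated at $x$. Setting. The unconditional data law is $p_0=\mathcal N(0,I_d)$; the conditional data law (for a fixed condition $y$) is the mixture in the statement. Data are noised by $x_t\mid x_0\sim\mathcal N((1-t)x_0,t^2I_d)$, so $$p_t(x)=\mathcal N\big(x;0,(t^2+(1-t)^2)I_d\big),\qquad p_t(x\mid y)=\sum_{k=1}^2\pi_k\,\mathcal N\big(x;(1-t)\mu_k,(t^2+(1-t)^2\sigma^2)I_d\big).$$ With $\alpha(t)=\frac1{1-t}$, $\beta(t)=\frac t{1-t}$ for $t\in[0,1)$, the CFG probability flow ODE with weight $\omega$ is $$\frac{dx_t}{dt}=-\alpha(t)x_t-\beta(t)\big[(1-\omega)\nabla_x\log p_t(x_t)+\omega\nabla_x\log p_t(x_t\mid y)\big].$$ It is solved backward in time, from $t=t_{s_1}$ down to $t=0$. *)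

theory Defs
  imports "HOL-Analysis.Analysis"
begin

definition gaussian :: "real^'d \<Rightarrow> real^'d \<Rightarrow> real^'d^'d \<Rightarrow> real" where
  "gaussian x m C =
     exp (- ((x - m) \<bullet> (matrix_inv C *v (x - m))) / 2) / sqrt ((2 * pi) ^ CARD('d) * det C)"

(* score p x is the gradient of log p at x; it is specified only where log p is differentiable,
   which for the Gaussian (mixture) densities below is everywhere. *)
definition score :: "(real^'d \<Rightarrow> real) \<Rightarrow> real^'d \<Rightarrow> real^'d" where
  "score p x = (THE D. GDERIV (\<lambda>z. ln (p z)) x :> D)"

(* The next two densities are the laws of x_t = (1 - t) x_0 + t \<epsilon>, with \<epsilon> standard normal
   and independent of x_0, in the cases x_0 ~ N(0, I) and
   x_0 ~ \<pi>\<^sub>1 N(\<mu>\<^sub>1, \<sigma>\<^sup>2 I) + \<pi>\<^sub>2 N(\<mu>\<^sub>2, \<sigma>\<^sup>2 I). *)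
definition uncond_density :: "real \<Rightarrow> real^'d \<Rightarrow> real" where
  "uncond_density t x = gaussian x 0 ((t\<^sup>2 + (1 - t)\<^sup>2) *\<^sub>R mat 1)"

definition cond_density ::
    "real \<Rightarrow> real \<Rightarrow> real \<Rightarrow> real^'d \<Rightarrow> real^'d \<Rightarrow> real \<Rightarrow> real^'d \<Rightarrow> real" where
  "cond_density \<sigma> \<pi>\<^sub>1 \<pi>\<^sub>2 \<mu>\<^sub>1 \<mu>\<^sub>2 t x =
     \<pi>\<^sub>1 * gaussian x ((1 - t) *\<^sub>R \<mu>\<^sub>1) ((t\<^sup>2 + (1 - t)\<^sup>2 * \<sigma>\<^sup>2) *\<^sub>R mat 1) +
     \<pi>\<^sub>2 * gaussian x ((1 - t) *\<^sub>R \<mu>\<^sub>2) ((t\<^sup>2 + (1 - t)\<^sup>2 * \<sigma>\<^sup>2) *\<^sub>R mat 1)"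

lemma uncond_density_0: "uncond_density 0 x = gaussian x 0 (mat 1)"
  by (simp add: uncond_density_def)

lemma cond_density_0:
  "cond_density \<sigma> \<pi>\<^sub>1 \<pi>\<^sub>2 \<mu>\<^sub>1 \<mu>\<^sub>2 0 x =
     \<pi>\<^sub>1 * gaussian x \<mu>\<^sub>1 (\<sigma>\<^sup>2 *\<^sub>R mat 1) + \<pi>\<^sub>2 * gaussian x \<mu>\<^sub>2 (\<sigma>\<^sup>2 *\<^sub>R mat 1)"
  by (simp add: cond_density_def)

definition \<alpha> :: "real \<Rightarrow> real" where "\<alpha> t = 1 / (1 - t)"

definition \<beta> :: "real \<Rightarrow> real" where "\<beta> t = t / (1 - t)"

(* Right-hand side of the classifier-free guidance (CFG) probability flow ODE;
   p t is the unconditional and q t the conditional density at time t. *)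
definition cfg_field ::
    "(real \<Rightarrow> real^'d \<Rightarrow> real) \<Rightarrow> (real \<Rightarrow> real^'d \<Rightarrow> real) \<Rightarrow> real \<Rightarrow> real \<Rightarrow> real^'d \<Rightarrow> real^'d" where
  "cfg_field p q \<omega> t x =
     - (\<alpha> t *\<^sub>R x) - \<beta> t *\<^sub>R ((1 - \<omega>) *\<^sub>R score (p t) x + \<omega> *\<^sub>R score (q t) x)"

(* Solving backward in time from T to 0 means that the value x T is the prescribed datum. *)
definition cfg_trajectory ::
    "(real \<Rightarrow> real^'d \<Rightarrow> real) \<Rightarrow> (real \<Rightarrow> real^'d \<Rightarrow> real) \<Rightarrow> real \<Rightarrow> real \<Rightarrow> (real \<Rightarrow> real^'d) \<Rightarrow> bool" where
  "cfg_trajectory p q \<omega> T x \<longleftrightarrow>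
     (\<forall>t\<in>{0..T}. (x has_vector_derivative cfg_field p q \<omega> t (x t)) (at t within {0..T}))"

end

theory Submission
  imports Defs
begin

text \<open>
  Put \<open>\<delta> = \<mu>\<^sub>2 - \<mu>\<^sub>1\<close>. Since the means have equal norm, the second component dominates the first at
  \<open>x\<close> as soon as \<open>\<pi>\<^sub>1 < \<pi>\<^sub>2\<close> and \<open>x \<bullet> \<delta> \<ge> 0\<close>. On the half-space \<open>x \<bullet> \<delta> > 0\<close> the guidance drift
  therefore pulls towards \<open>\<mu>\<^sub>2\<close>, so that \<open>a t = x t \<bullet> \<delta>\<close> satisfies \<open>a' \<le> K a\<close> there, and a
  backward Gronwall argument shows that solutions ending in this half-space have always been in it. As
  \<open>\<mu>' \<bullet> \<delta> > 0\<close> unless \<open>\<delta> = 0\<close>, the point \<open>k \<mu>'\<close> lies in it, at a distance from its boundary proportional to \<open>k\<close>;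
  this distance is the radius. Any terminal time in \<open>(0, 1)\<close> would do.
\<close>

section \<open>Isotropic Gaussians and their scores\<close>

lemma matrix_inv_scaleR_mat_1:
  assumes "c \<noteq> 0"
  shows "matrix_inv (c *\<^sub>R mat 1 :: real^'n^'n) = (1 / c) *\<^sub>R mat 1"
proof -
  let ?A = "c *\<^sub>R mat 1 :: real^'n^'n" and ?B = "(1 / c) *\<^sub>R mat 1 :: real^'n^'n"
  have AB: "?A ** ?B = mat 1" and BA: "?B ** ?A = mat 1"
    using assms by (simp_all add: matrix_scalar_ac scalar_matrix_assoc[symmetric])
  then have "matrix_inv ?A ** ?A = mat 1"
    unfolding matrix_inv_def by (rule someI2[of _ ?B, OF conjI]) simp
  \<comment> \<open>\<open>matrix_inv\<close> is a choice operator, so the chosen left inverse is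
    identified with \<open>?B\<close> by multiplying with the right inverse
    \<open>?B\<close>.\<close>
  then show ?thesis
    by (metis AB matrix_mul_assoc matrix_mul_lid matrix_mul_rid)
qed

lemma det_scaleR_mat_1: "det (c *\<^sub>R mat 1 :: real^'n^'n) = c ^ CARD('n)"
proof -
  have "det (c *\<^sub>R mat 1 :: real^'n^'n) = (\<Prod>i\<in>UNIV. (c *\<^sub>R mat 1 :: real^'n^'n) $ i $ i)"
    by (rule det_diagonal) (simp add: mat_def)
  then show ?thesis by (simp add: mat_def)
qed

lemma gaussian_isotropic:
  fixes x m :: "real^'d"
  assumes "c > 0"
  shows "gaussian x m (c *\<^sub>R mat 1) =
    exp (- ((x - m) \<bullet> (x - m)) / (2 * c)) / sqrt ((2 * pi * c) ^ CARD('d))"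
  using assms
  by (simp add: gaussian_def matrix_inv_scaleR_mat_1 det_scaleR_mat_1 power_mult_distrib
      scaleR_matrix_vector_assoc[symmetric] mult.commute)

lemma gaussian_isotropic_pos:
  assumes "c > 0"
  shows "gaussian x m (c *\<^sub>R mat 1) > 0"
  using assms by (simp add: gaussian_isotropic)

lemma has_derivative_gaussian_isotropic:
  fixes x m :: "real^'d"
  assumes "c > 0"
  shows "((\<lambda>z. gaussian z m (c *\<^sub>R mat 1)) has_derivative
    (\<lambda>h. - (gaussian x m (c *\<^sub>R mat 1) / c) * (h \<bullet> (x - m)))) (at x)"
proof -
  define Z where "Z = sqrt ((2 * pi * c) ^ CARD('d))"
  have "Z \<noteq> 0"
    using assms by (simp add: Z_def)
  then show ?thesis
    unfolding gaussian_isotropic[OF assms] Z_def[symmetric] using assms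
    by (auto intro!: derivative_eq_intros simp: fun_eq_iff field_simps inner_commute)
qed

text \<open>Discharges the definite description in \<open>score\<close>: derivatives at a point are
  unique, and the inner product determines the gradient from the derivative.\<close>

lemma score_eqI:
  assumes "GDERIV (\<lambda>z. ln (p z)) x :> D"
  shows "score p x = D"
proof -
  have "E = D" if "GDERIV (\<lambda>z. ln (p z)) x :> E" for E
  proof -
    have "(\<lambda>h. h \<bullet> E) = (\<lambda>h. h \<bullet> D)"
      using that assms has_derivative_unique unfolding gderiv_def by blast
    then show ?thesis by (metis vector_eq_ldot)
  qed
  with assms show ?thesis unfolding score_def by blast
qed

lemma score_gaussian_isotropic:
  fixes x m :: "real^'d"
  assumes "c > 0"
  shows "score (\<lambda>z. gaussian z m (c *\<^sub>R mat 1)) x = - ((1 / c) *\<^sub>R (x - m))"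
proof (rule score_eqI)
  have pos: "gaussian x m (c *\<^sub>R mat 1) > 0"
    using assms by (rule gaussian_isotropic_pos)
  show "GDERIV (\<lambda>z. ln (gaussian z m (c *\<^sub>R mat 1))) x :> - ((1 / c) *\<^sub>R (x - m))"
    unfolding gderiv_def
    by (rule derivative_eq_intros has_derivative_gaussian_isotropic assms refl pos)+
      (use assms pos in \<open>simp add: fun_eq_iff\<close>)
qed

text \<open>The component scores, averaged with the posterior weights of the components, combine to
  the score of a single Gaussian centred at the posterior mean of \<open>m\<^sub>1\<close> and
  \<open>m\<^sub>2\<close>.\<close>

lemma score_gaussian_mixture:
  fixes x m\<^sub>1 m\<^sub>2 :: "real^'d"
  defines "g \<equiv> \<lambda>m c x :: real^'d. gaussian x m (c *\<^sub>R mat 1)"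
  assumes "c > 0" "p\<^sub>1 > 0" "p\<^sub>2 > 0"
  shows "score (\<lambda>z. p\<^sub>1 * g m\<^sub>1 c z + p\<^sub>2 * g m\<^sub>2 c z) x =
    - ((1 / c) *\<^sub>R (x - (1 / (p\<^sub>1 * g m\<^sub>1 c x + p\<^sub>2 * g m\<^sub>2 c x)) *\<^sub>R
        ((p\<^sub>1 * g m\<^sub>1 c x) *\<^sub>R m\<^sub>1 + (p\<^sub>2 * g m\<^sub>2 c x) *\<^sub>R m\<^sub>2)))"
    (is "_ = ?D")
proof (rule score_eqI)
  have pos: "g m\<^sub>1 c x > 0" "g m\<^sub>2 c x > 0"
    using gaussian_isotropic_pos[OF \<open>c > 0\<close>] by (simp_all add: g_def)
  then have q: "p\<^sub>1 * g m\<^sub>1 c x + p\<^sub>2 * g m\<^sub>2 c x > 0"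
    using assms by (simp add: add_pos_pos)
  have der: "(g m c has_derivative (\<lambda>h. - (g m c x / c) * (h \<bullet> (x - m)))) (at x)" for m
    unfolding g_def by (rule has_derivative_gaussian_isotropic[OF \<open>c > 0\<close>])
  show "GDERIV (\<lambda>z. ln (p\<^sub>1 * g m\<^sub>1 c z + p\<^sub>2 * g m\<^sub>2 c z)) x :> ?D"
    unfolding gderiv_def
    by (rule derivative_eq_intros der refl q)+
      (use q \<open>c > 0\<close> in \<open>simp add: fun_eq_iff inner_diff_right inner_add_right divide_simps,
        simp add: algebra_simps\<close>)
qed

section \<open>Domination and drift on the half-space\<close>

text \<open>For centres of equal norm, the squared distances of \<open>x\<close> to
  \<open>m\<^sub>1\<close> and \<open>m\<^sub>2\<close> differ by twice
  \<open>x \<bullet> (m\<^sub>2 - m\<^sub>1)\<close>, so \<open>m\<^sub>2\<close> is at least as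
  near. Strictness comes from the weights alone, hence the boundary hyperplane is included.\<close>

lemma gaussian_mixture_dominates:
  fixes x m\<^sub>1 m\<^sub>2 :: "real^'d"
  assumes "c > 0" "norm m\<^sub>1 = norm m\<^sub>2" "0 < p\<^sub>1" "p\<^sub>1 < p\<^sub>2" "x \<bullet> (m\<^sub>2 - m\<^sub>1) \<ge> 0"
  shows "p\<^sub>1 * gaussian x m\<^sub>1 (c *\<^sub>R mat 1) < p\<^sub>2 * gaussian x m\<^sub>2 (c *\<^sub>R mat 1)"
proof -
  have "m\<^sub>1 \<bullet> m\<^sub>1 = m\<^sub>2 \<bullet> m\<^sub>2"
    using assms(2) by (simp add: norm_eq)
  then have "(x - m\<^sub>2) \<bullet> (x - m\<^sub>2) \<le> (x - m\<^sub>1) \<bullet> (x - m\<^sub>1)"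
    using assms(5) by (simp add: inner_diff_left inner_diff_right inner_commute)
  then have "gaussian x m\<^sub>1 (c *\<^sub>R mat 1) \<le> gaussian x m\<^sub>2 (c *\<^sub>R mat 1)"
    using \<open>c > 0\<close> by (simp add: gaussian_isotropic divide_right_mono)
  then show ?thesis
    using \<open>0 < p\<^sub>1\<close> \<open>p\<^sub>1 < p\<^sub>2\<close> gaussian_isotropic_pos[OF \<open>c > 0\<close>]
    by (intro mult_less_le_imp_less) (auto intro: less_imp_le)
qed

text \<open>The posterior mean leans towards \<open>m\<^sub>2\<close> here, so dropping it from the
  score can only lower the component along \<open>m\<^sub>2 - m\<^sub>1\<close>; the score of a
  centred Gaussian is left as lower bound.\<close>

lemma inner_score_gaussian_mixture_ge:
  fixes x m\<^sub>1 m\<^sub>2 :: "real^'d"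
  assumes "c > 0" "norm m\<^sub>1 = norm m\<^sub>2" "0 < p\<^sub>1" "p\<^sub>1 < p\<^sub>2" "x \<bullet> (m\<^sub>2 - m\<^sub>1) \<ge> 0"
  shows "score (\<lambda>z. p\<^sub>1 * gaussian z m\<^sub>1 (c *\<^sub>R mat 1) + p\<^sub>2 * gaussian z m\<^sub>2 (c *\<^sub>R mat 1)) x
      \<bullet> (m\<^sub>2 - m\<^sub>1) \<ge> - (x \<bullet> (m\<^sub>2 - m\<^sub>1) / c)"
proof -
  define u where "u = p\<^sub>1 * gaussian x m\<^sub>1 (c *\<^sub>R mat 1)"
  define w where "w = p\<^sub>2 * gaussian x m\<^sub>2 (c *\<^sub>R mat 1)"
  have u: "u > 0" and uw: "u < w"
    using gaussian_isotropic_pos[OF \<open>c > 0\<close>] gaussian_mixture_dominates[OF assms] \<open>0 < p\<^sub>1\<close>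
    by (auto simp: u_def w_def intro: mult_pos_pos)
  have eq: "m\<^sub>1 \<bullet> m\<^sub>1 = m\<^sub>2 \<bullet> m\<^sub>2"
    using assms(2) by (simp add: norm_eq)
  \<comment> \<open>By equal norms the midpoint of the centres is orthogonal to their difference, so
    only the part \<open>(w - u) / 2\<close> times the difference survives.\<close>
  have "(u *\<^sub>R m\<^sub>1 + w *\<^sub>R m\<^sub>2) \<bullet> (m\<^sub>2 - m\<^sub>1) = (w - u) * ((m\<^sub>2 - m\<^sub>1) \<bullet> (m\<^sub>2 - m\<^sub>1)) / 2"
    using eq by (simp add: inner_diff_left inner_diff_right inner_add_left inner_commute algebra_simps)
  also have "\<dots> \<ge> 0"
    using uw by simp
  finally have "(u *\<^sub>R m\<^sub>1 + w *\<^sub>R m\<^sub>2) \<bullet> (m\<^sub>2 - m\<^sub>1) \<ge> 0" .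
  then have "(1 / (u + w)) * ((u *\<^sub>R m\<^sub>1 + w *\<^sub>R m\<^sub>2) \<bullet> (m\<^sub>2 - m\<^sub>1)) / c \<ge> 0"
    using u uw \<open>c > 0\<close> by simp
  moreover have "score (\<lambda>z. p\<^sub>1 * gaussian z m\<^sub>1 (c *\<^sub>R mat 1) + p\<^sub>2 * gaussian z m\<^sub>2 (c *\<^sub>R mat 1)) x
     = - ((1 / c) *\<^sub>R (x - (1 / (u + w)) *\<^sub>R (u *\<^sub>R m\<^sub>1 + w *\<^sub>R m\<^sub>2)))"
    unfolding u_def w_def
    by (rule score_gaussian_mixture) (use assms in auto)
  ultimately show ?thesis
    by (simp add: inner_diff_left diff_divide_distrib)
qed

section \<open>Backward Gronwall estimate along trajectories\<close>

text \<open>The bound on \<open>a'\<close> is required only where \<open>a\<close> is positive,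
  since it is applied only after the last time at which \<open>a\<close> is nonpositive.\<close>

lemma backward_positivity:
  fixes a a' :: "real \<Rightarrow> real"
  assumes der: "\<And>t. t \<in> {0..T} \<Longrightarrow> (a has_real_derivative a' t) (at t within {0..T})"
    and le: "\<And>t. t \<in> {0..T} \<Longrightarrow> a t > 0 \<Longrightarrow> a' t \<le> K * a t"
    and "a T > 0" and t: "t \<in> {0..T}"
  shows "a t > 0"
proof (rule ccontr)
  assume "\<not> a t > 0"
  define S where "S = {0..T} \<inter> a -` {..0}"
  define s where "s = Sup S"
  have cont: "continuous_on {0..T} a"
    using der DERIV_continuous_on by blast
  have "closed S"
    unfolding S_def by (rule continuous_closed_preimage[OF cont]) auto
  moreover have bdd: "bdd_above S"
    by (auto simp: S_def)
  moreover have "S \<noteq> {}"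
    using t \<open>\<not> a t > 0\<close> by (auto simp: S_def)
  ultimately have "s \<in> S"
    unfolding s_def by (intro closed_contains_Sup)
  then have s: "0 \<le> s" "s \<le> T" "a s \<le> 0"
    by (auto simp: S_def)
  have pos: "a z > 0" if "s < z" "z \<le> T" for z
    using that s cSup_upper[OF _ bdd, of z] by (force simp: S_def s_def)
  \<comment> \<open>The integrating factor turns the bound into monotonicity. At \<open>s\<close>
    itself \<open>a\<close> is not positive and no bound is available, so the derivative is used on
    the open interval, with continuity at the ends.\<close>
  have "a T * exp (- K * T) \<le> a s * exp (- K * s)"
  proof (rule DERIV_nonpos_imp_decreasing_open[OF \<open>s \<le> T\<close>])
    show "continuous_on {s..T} (\<lambda>z. a z * exp (- K * z))"
      using s by (intro continuous_intros continuous_on_subset[OF cont]) auto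
    fix z assume z: "s < z" "z < T"
    then have "(a has_real_derivative a' z) (at z)"
      using der[of z] s at_within_interior[of z "{0..T}"] by simp
    then have "((\<lambda>z. a z * exp (- K * z)) has_real_derivative (a' z - K * a z) * exp (- K * z)) (at z)"
      by (auto intro!: derivative_eq_intros simp: algebra_simps)
    moreover have "(a' z - K * a z) * exp (- K * z) \<le> 0"
      using le[of z] pos[of z] z s by (simp add: mult_le_0_iff)
    ultimately show "\<exists>y. ((\<lambda>z. a z * exp (- K * z)) has_real_derivative y) (at z) \<and> y \<le> 0"
      by blast
  qed
  then show False
    using \<open>a T > 0\<close> s
    by (smt (verit) exp_gt_zero mult_nonpos_nonneg mult_pos_pos)
qed

lemma cfg_trajectory_half_space:
  fixes \<mu>\<^sub>1 \<mu>\<^sub>2 :: "real^'d" and x :: "real \<Rightarrow> real^'d"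
  assumes "\<sigma> > 0" "norm \<mu>\<^sub>1 = norm \<mu>\<^sub>2" "0 < \<pi>\<^sub>1" "\<pi>\<^sub>1 < \<pi>\<^sub>2" "\<omega> \<ge> 1" "T < 1"
    and traj: "cfg_trajectory uncond_density (cond_density \<sigma> \<pi>\<^sub>1 \<pi>\<^sub>2 \<mu>\<^sub>1 \<mu>\<^sub>2) \<omega> T x"
    and "x T \<bullet> (\<mu>\<^sub>2 - \<mu>\<^sub>1) > 0" and t: "t \<in> {0..T}"
  shows "x t \<bullet> (\<mu>\<^sub>2 - \<mu>\<^sub>1) > 0"
proof -
  define \<delta> where "\<delta> = \<mu>\<^sub>2 - \<mu>\<^sub>1"
  define a where "a = (\<lambda>t. x t \<bullet> \<delta>)"
  define f where "f = cfg_field uncond_density (cond_density \<sigma> \<pi>\<^sub>1 \<pi>\<^sub>2 \<mu>\<^sub>1 \<mu>\<^sub>2) \<omega>"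
  \<comment> \<open>Bounds \<open>\<omega> * t / ((1 - t) * v)\<close> uniformly on
    \<open>{0..T}\<close>, by \<open>t \<le> 1\<close>, \<open>1 - T \<le> 1 - t\<close> and the
    lower bound on the variance \<open>v\<close>; it is finite because \<open>T < 1\<close>.\<close>
  define K where "K = \<omega> / ((1 - T) * ((1 - T)\<^sup>2 * \<sigma>\<^sup>2))"
  have "a t > 0"
  proof (rule backward_positivity[where a = a and T = T and a' = "\<lambda>t. f t (x t) \<bullet> \<delta>" and K = K])
    show "(a has_real_derivative f t (x t) \<bullet> \<delta>) (at t within {0..T})" if "t \<in> {0..T}" for t
    proof -
      have "(x has_vector_derivative f t (x t)) (at t within {0..T})"
        using traj that by (simp add: cfg_trajectory_def f_def)
      then show ?thesis
        unfolding a_def has_real_derivative_iff_has_vector_derivative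
        by (rule bounded_linear.has_vector_derivative[OF bounded_linear_inner_left])
    qed
    show "f t (x t) \<bullet> \<delta> \<le> K * a t" if t: "t \<in> {0..T}" and pos: "a t > 0" for t
    proof -
      define s where "s = t\<^sup>2 + (1 - t)\<^sup>2"
      define v where "v = t\<^sup>2 + (1 - t)\<^sup>2 * \<sigma>\<^sup>2"
      have t01: "0 \<le> t" "t < 1" "1 - T \<le> 1 - t" "0 < 1 - T"
        using t \<open>T < 1\<close> by auto
      have "(1 - T)\<^sup>2 * \<sigma>\<^sup>2 \<le> (1 - t)\<^sup>2 * \<sigma>\<^sup>2"
        using t01 by (intro mult_right_mono power_mono) auto
      then have v: "(1 - T)\<^sup>2 * \<sigma>\<^sup>2 \<le> v"
        unfolding v_def by (simp add: add_increasing)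
      moreover have v0: "0 < (1 - T)\<^sup>2 * \<sigma>\<^sup>2"
        using t01 \<open>\<sigma> > 0\<close> by simp
      ultimately have "v > 0"
        by linarith
      have "s > 0"
        using t01 by (simp add: s_def add_nonneg_pos)
      have su: "score (uncond_density t) (x t) \<bullet> \<delta> = - (a t / s)"
        using score_gaussian_isotropic[OF \<open>s > 0\<close>, of 0 "x t"]
        by (simp add: uncond_density_def[abs_def] s_def a_def)
      have \<delta>t: "(1 - t) *\<^sub>R \<mu>\<^sub>2 - (1 - t) *\<^sub>R \<mu>\<^sub>1 = (1 - t) *\<^sub>R \<delta>"
        by (simp add: \<delta>_def scaleR_diff_right)
      \<comment> \<open>The centres at time \<open>t\<close> differ by
        \<open>(1 - t) *\<^sub>R \<delta>\<close>; the positive factor \<open>1 - t\<close> is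
        cancelled afterwards.\<close>
      have "score (cond_density \<sigma> \<pi>\<^sub>1 \<pi>\<^sub>2 \<mu>\<^sub>1 \<mu>\<^sub>2 t) (x t) \<bullet> ((1 - t) *\<^sub>R \<delta>)
          \<ge> - (x t \<bullet> ((1 - t) *\<^sub>R \<delta>) / v)"
        unfolding cond_density_def[abs_def] v_def[symmetric] \<delta>t[symmetric]
      proof (rule inner_score_gaussian_mixture_ge)
        show "0 \<le> x t \<bullet> ((1 - t) *\<^sub>R \<mu>\<^sub>2 - (1 - t) *\<^sub>R \<mu>\<^sub>1)"
          using t01 pos by (simp add: \<delta>t a_def)
      qed (use assms \<open>v > 0\<close> in auto)
      then have "(1 - t) * (- (a t / v)) \<le> (1 - t) * (score (cond_density \<sigma> \<pi>\<^sub>1 \<pi>\<^sub>2 \<mu>\<^sub>1 \<mu>\<^sub>2 t) (x t) \<bullet> \<delta>)"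
        by (simp add: a_def)
      then have sc: "- (a t / v) \<le> score (cond_density \<sigma> \<pi>\<^sub>1 \<pi>\<^sub>2 \<mu>\<^sub>1 \<mu>\<^sub>2 t) (x t) \<bullet> \<delta>"
        using t01 by (simp only: mult_le_cancel_left_pos)
      have "f t (x t) \<bullet> \<delta> = - (\<alpha> t * a t) - \<beta> t * ((\<omega> - 1) * (a t / s)
          + \<omega> * (score (cond_density \<sigma> \<pi>\<^sub>1 \<pi>\<^sub>2 \<mu>\<^sub>1 \<mu>\<^sub>2 t) (x t) \<bullet> \<delta>))"
        unfolding f_def cfg_field_def
        by (simp add: inner_diff_left inner_add_left su) (simp add: a_def algebra_simps diff_divide_distrib)
      \<comment> \<open>As \<open>\<omega> \<ge> 1\<close>, the negatively weighted unconditional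
        score only lowers the drift and is bounded by 0. The next estimate discards the
        \<open>\<alpha>\<close> term for its sign.\<close>
      also have "\<dots> \<le> - (\<alpha> t * a t) - \<beta> t * (0 + \<omega> * - (a t / v))"
        using sc t01 pos \<open>\<omega> \<ge> 1\<close> \<open>s > 0\<close>
        by (intro diff_left_mono mult_left_mono add_mono) (auto simp: \<beta>_def)
      also have "\<dots> \<le> \<omega> * t / ((1 - t) * v) * a t"
        using t01 pos by (simp add: \<alpha>_def \<beta>_def mult_ac)
      also have "\<dots> \<le> K * a t"
        unfolding K_def using t01 v v0 pos \<open>\<omega> \<ge> 1\<close>
        by (intro mult_right_mono frac_le mult_mono) (auto simp: mult_left_le)
      finally show ?thesis .
    qed
  qed (use assms in \<open>auto simp: a_def \<delta>_def\<close>)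
  then show ?thesis by (simp add: a_def \<delta>_def)
qed

theorem proposition3p4:
  fixes \<mu>\<^sub>1 \<mu>\<^sub>2 \<mu>' :: "real^'d" and \<sigma> \<pi>\<^sub>1 \<pi>\<^sub>2 \<omega> :: real
  assumes "0 < \<sigma>" and "\<sigma> < 1"
    and "norm \<mu>\<^sub>1 = norm \<mu>\<^sub>2"
    and "\<pi>\<^sub>1 > 0" and "\<pi>\<^sub>2 > 0" and "\<pi>\<^sub>1 + \<pi>\<^sub>2 = 1" and "\<pi>\<^sub>1 < \<pi>\<^sub>2"
    and "\<omega> \<ge> 1"
    and "\<mu>' = \<pi>\<^sub>1 *\<^sub>R \<mu>\<^sub>1 + \<pi>\<^sub>2 *\<^sub>R \<mu>\<^sub>2"
  shows "\<exists>ts. 0 < ts \<and> ts < 1 \<and>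
    (\<exists>r :: real \<Rightarrow> real.
      strict_mono_on {1<..} r \<and>
      (\<forall>k>1. r k > 0 \<and>
        (\<forall>x :: real \<Rightarrow> real^'d.
          cfg_trajectory uncond_density (cond_density \<sigma> \<pi>\<^sub>1 \<pi>\<^sub>2 \<mu>\<^sub>1 \<mu>\<^sub>2) \<omega> ts x \<longrightarrow>
          norm (x ts - k *\<^sub>R \<mu>') < r k \<longrightarrow>
          (\<forall>t\<in>{0..ts}.
            \<pi>\<^sub>1 * gaussian (x t) ((1 - t) *\<^sub>R \<mu>\<^sub>1) ((t\<^sup>2 + (1 - t)\<^sup>2 * \<sigma>\<^sup>2) *\<^sub>R mat 1)
            < \<pi>\<^sub>2 * gaussian (x t) ((1 - t) *\<^sub>R \<mu>\<^sub>2) ((t\<^sup>2 + (1 - t)\<^sup>2 * \<sigma>\<^sup>2) *\<^sub>R mat 1)))))"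
proof -
  define \<delta> where "\<delta> = \<mu>\<^sub>2 - \<mu>\<^sub>1"
  \<comment> \<open>For \<open>\<delta>\<close> nonzero, this is the distance of
    \<open>\<mu>'\<close> from the hyperplane orthogonal to \<open>\<delta>\<close>. For
    \<open>\<delta> = 0\<close> any positive value serves; 1 keeps the radius positive and strictly
    increasing in \<open>k\<close>.\<close>
  define \<rho> where "\<rho> = (if \<delta> = 0 then 1 else (\<pi>\<^sub>2 - \<pi>\<^sub>1) * norm \<delta> / 2)"
  have "\<rho> > 0"
    using \<open>\<pi>\<^sub>1 < \<pi>\<^sub>2\<close> by (simp add: \<rho>_def)
  have eq: "\<mu>\<^sub>1 \<bullet> \<mu>\<^sub>1 = \<mu>\<^sub>2 \<bullet> \<mu>\<^sub>2"
    using assms(3) by (simp add: norm_eq)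
  have "\<mu>' \<bullet> \<delta> = (\<pi>\<^sub>2 - \<pi>\<^sub>1) * (\<delta> \<bullet> \<delta>) / 2"
    using eq by (simp add: assms(9) \<delta>_def inner_diff_left inner_diff_right inner_add_left
        inner_commute algebra_simps)
  then have \<mu>'\<delta>: "\<mu>' \<bullet> \<delta> = \<rho> * norm \<delta>"
    by (simp add: \<rho>_def power2_norm_eq_inner[symmetric] power2_eq_square)
  have claim: "\<pi>\<^sub>1 * gaussian (x t) ((1 - t) *\<^sub>R \<mu>\<^sub>1) ((t\<^sup>2 + (1 - t)\<^sup>2 * \<sigma>\<^sup>2) *\<^sub>R mat 1)
      < \<pi>\<^sub>2 * gaussian (x t) ((1 - t) *\<^sub>R \<mu>\<^sub>2) ((t\<^sup>2 + (1 - t)\<^sup>2 * \<sigma>\<^sup>2) *\<^sub>R mat 1)"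
    if traj: "cfg_trajectory uncond_density (cond_density \<sigma> \<pi>\<^sub>1 \<pi>\<^sub>2 \<mu>\<^sub>1 \<mu>\<^sub>2) \<omega> (1 / 2) x"
      and near: "norm (x (1 / 2) - k *\<^sub>R \<mu>') < k * \<rho>" and t: "t \<in> {0..1 / 2}"
    for k t :: real and x :: "real \<Rightarrow> real^'d"
  proof (rule gaussian_mixture_dominates)
    \<comment> \<open>The weak inequality also covers \<open>\<delta> = 0\<close>. Otherwise
      Cauchy-Schwarz keeps the ball of radius \<open>k * \<rho>\<close> about
      \<open>k *\<^sub>R \<mu>'\<close> inside the open half-space.\<close>
    have "x t \<bullet> \<delta> \<ge> 0"
    proof (cases "\<delta> = 0")
      case False
      have "- ((x (1 / 2) - k *\<^sub>R \<mu>') \<bullet> \<delta>) \<le> norm (x (1 / 2) - k *\<^sub>R \<mu>') * norm \<delta>"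
        using Cauchy_Schwarz_ineq2[of "x (1 / 2) - k *\<^sub>R \<mu>'" \<delta>] by linarith
      also have "\<dots> < k * \<rho> * norm \<delta>"
        using near False by (intro mult_strict_right_mono) auto
      finally have "x (1 / 2) \<bullet> \<delta> > 0"
        by (simp add: inner_diff_left \<mu>'\<delta>)
      then show ?thesis
        using cfg_trajectory_half_space[OF _ _ _ _ _ _ traj _ t] assms by (simp add: \<delta>_def)
    qed simp
    then show "0 \<le> x t \<bullet> ((1 - t) *\<^sub>R \<mu>\<^sub>2 - (1 - t) *\<^sub>R \<mu>\<^sub>1)"
      using t by (simp add: \<delta>_def flip: scaleR_diff_right)
    show "0 < t\<^sup>2 + (1 - t)\<^sup>2 * \<sigma>\<^sup>2"
      using t \<open>0 < \<sigma>\<close> by (intro add_nonneg_pos) auto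
  qed (use assms in auto)
  have "strict_mono_on {1<..} (\<lambda>k. k * \<rho>)"
    using \<open>\<rho> > 0\<close> by (simp add: strict_mono_on_def)
  then show ?thesis
    using claim \<open>\<rho> > 0\<close> by (intro exI[of _ "1 / 2"] exI[of _ "\<lambda>k. k * \<rho>"] conjI allI impI ballI) auto
qed

end
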